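(* Let $p$ be an odd prime, $\lambda\in\mathbb{Z}_p$ with $\lambda\ne0$, and $x\in\mathbb{C}_p$. For every integer $m\ge0$, \[ \frac{\lambda^m}{2}E_m\!\left(\frac{\lambda+x}{\lambda}\right)=\sum_{n=0}^{m}\hat{B}l_n(x|\lambda)\,S_2(m,n), \] and \[ \hat{B}l_m(x|\lambda)=\sum_{l=0}^{m}S_1(m,l)(-1)^l\frac{\lambda^l}{2}E_l\!\left(-\frac{x}{\lambda}\right). \]
   Context: For a continuous $f:\mathbb{Z}_p\to\mathbb{C}_p$, the fermionic $p$-adic integral is $\int_{\mathbb{Z}_p}f(y)\,d\mu_{-1}(y)=\lim_{N\to\infty}\sum_{a=0}^{p^N-1}f(a)(-1)^a$. $(z)_n=z(z-1)\cdots(z-n+1)$ is the falling factorial. The Boole polynomials of the second kind are defined by \[ \hat{B}l_n(x|\lambda)=\frac12\int_{\mathbb{Z}_p}(-\lambda y+x)_n\,d\mu_{-1}(y)\quad (n\ge0). \] The Euler polynomials $E_n(x)$ are defined by $\frac{2}{e^t+1}e^{xt}=\sum_{n\ge0}E_n(x)\frac{t^n}{n!}$. The Stirling numbers of the first kind $S_1(n,l)$ are defined by $(x)_n=\sum_{l=0}^nS_1(n,l)x^l$. The Stirling numbers of the second kind are defined by $(e^t-1)^n=n!\sum_{l\ge n}S_2(l,n)\frac{t^l}{l!}$. *)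

theory Defs
  imports "HOL-Analysis.Analysis" "HOL-Combinatorics.Stirling"
    "HOL-Computational_Algebra.Computational_Algebra"
begin

text \<open>
  The library has no type of $p$-adic complex numbers. The field $\mathbb{C}_p$ is therefore
  given as any model of its definition, the completion of an algebraic closure of
  $\mathbb{Q}_p$, which determines it up to isometric isomorphism. The underlying type is a
  complete metric space whose metric comes from an absolute value. The closure of the rationals
  in it is the completion of the rationals, that is, $\mathbb{Q}_p$.
\<close>

definition Q_padic :: "'a::{field_char_0, metric_space} set"
  where "Q_padic = closure \<rat>"

definition Q_padic_alg :: "'a::{field_char_0, metric_space} set"
  where "Q_padic_alg = {z. \<exists>q. q \<noteq> 0 \<and> (\<forall>i. coeff q i \<in> Q_padic) \<and> poly q z = 0}"

text \<open>
  A multiplicative ultrametric absolute value with $|p| = 1/p$ restricts on the rationals to the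
  \<open>p\<close>-adic absolute value. Assumptions \<open>alg_closed\<close> and \<open>dense\<close>
  say that the subfield of elements algebraic over $\mathbb{Q}_p$ is algebraically closed (hence
  is an algebraic closure of $\mathbb{Q}_p$) and that the whole field is its completion;
  completeness itself is the class constraint.
\<close>

locale padic_complex =
  fixes p :: nat and vabs :: "'a::{field_char_0, complete_space} \<Rightarrow> real"
  assumes prime_p: "prime p"
    and dist_vabs: "dist x y = vabs (x - y)"
    and vabs_mult: "vabs (x * y) = vabs x * vabs y"
    and vabs_ultra: "vabs (x + y) \<le> max (vabs x) (vabs y)"
    and vabs_p: "vabs (of_nat p) = 1 / real p"
    and alg_closed: "\<lbrakk>degree q > 0; \<forall>i. coeff q i \<in> Q_padic_alg\<rbrakk> \<Longrightarrow> \<exists>z::'a. poly q z = 0"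
    and dense: "closure (Q_padic_alg :: 'a set) = UNIV"

definition Z_padic :: "('a::{field_char_0, metric_space} \<Rightarrow> real) \<Rightarrow> 'a set"
  where "Z_padic vabs = {z \<in> Q_padic. vabs z \<le> 1}"

text \<open>
  Only the values of the integrand at natural numbers enter. If the limit does not exist, the
  value is unspecified.
\<close>

definition fermionic_integral :: "nat \<Rightarrow> ('a::{field_char_0, metric_space} \<Rightarrow> 'a) \<Rightarrow> 'a"
  where "fermionic_integral p f = lim (\<lambda>N. \<Sum>a<p ^ N. f (of_nat a) * (- 1) ^ a)"

definition falling_fact :: "'a::comm_ring_1 \<Rightarrow> nat \<Rightarrow> 'a"
  where "falling_fact z n = (\<Prod>i<n. z - of_nat i)"

definition Boole2 :: "nat \<Rightarrow> nat \<Rightarrow> 'a::{field_char_0, metric_space} \<Rightarrow> 'a \<Rightarrow> 'a"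
  where "Boole2 p n x lam = 1 / 2 * fermionic_integral p (\<lambda>y. falling_fact (- lam * y + x) n)"

definition Euler_poly :: "nat \<Rightarrow> 'a::field_char_0 \<Rightarrow> 'a"
  where "Euler_poly n x = fact n * fps_nth (2 / (fps_exp 1 + 1) * fps_exp x) n"

lemma Euler_poly_generating_function:
  fixes x :: "'a::field_char_0"
  shows "Abs_fps (\<lambda>n. Euler_poly n x / fact n) = 2 / (fps_exp 1 + 1) * fps_exp x"
  by (rule fps_ext) (simp add: Euler_poly_def)

text \<open>
  Signed Stirling numbers of the first kind; the library's \<^const>\<open>stirling\<close> is unsigned.
\<close>

definition Stirling1 :: "nat \<Rightarrow> nat \<Rightarrow> int"
  where "Stirling1 n l = coeff (falling_fact [:0, 1:] n) l"

lemma falling_fact_poly: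
  "falling_fact [:0, 1:] n = (\<Prod>i<n. [:- of_nat i, 1:] :: 'a::comm_ring_1 poly)"
  by (simp add: falling_fact_def of_nat_poly)

lemma degree_falling_fact: "degree (falling_fact [:0, 1:] n :: int poly) = n"
  unfolding falling_fact_poly by (subst degree_prod_eq_sum_degree) auto

lemma falling_fact_Stirling1:
  fixes x :: "'a::comm_ring_1"
  shows "falling_fact x n = (\<Sum>l\<le>n. of_int (Stirling1 n l) * x ^ l)"
proof -
  have "falling_fact x n = poly (map_poly of_int (falling_fact [:0, 1:] n)) x"
  proof (induction n)
    case 0
    show ?case by (simp add: falling_fact_def)
  next
    case (Suc n)
    have "map_poly of_int (falling_fact [:0, 1:] (Suc n)) =
        (map_poly of_int (falling_fact [:0, 1:] n) * [:- of_nat n, 1:] :: 'a poly)"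
    proof (rule poly_eqI)
      fix k
      show "coeff (map_poly of_int (falling_fact [:0, 1:] (Suc n))) k =
        coeff (map_poly of_int (falling_fact [:0, 1:] n) * [:- of_nat n, 1:] :: 'a poly) k"
        by (cases k) (simp_all add: falling_fact_poly coeff_map_poly algebra_simps)
    qed
    hence "poly (map_poly of_int (falling_fact [:0, 1:] (Suc n))) x =
        poly (map_poly of_int (falling_fact [:0, 1:] n)) x * (x - of_nat n)"
      by (simp only: poly_mult) simp
    thus ?case using Suc by (simp add: falling_fact_def)
  qed
  also have "\<dots> = (\<Sum>l\<le>n. of_int (Stirling1 n l) * x ^ l)"
  proof -
    let ?q = "map_poly of_int (falling_fact [:0, 1:] n) :: 'a poly"
    have "poly ?q x = (\<Sum>l\<le>n. coeff ?q l * x ^ l)"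
      unfolding poly_altdef
      using map_poly_degree_leq[of of_int "falling_fact [:0, 1:] n :: int poly"]
      by (intro sum.mono_neutral_left) (auto simp: degree_falling_fact coeff_eq_0)
    thus ?thesis by (simp add: Stirling1_def coeff_map_poly)
  qed
  finally show ?thesis .
qed

text \<open>
  The library's \<^const>\<open>Stirling\<close> is the sequence of Stirling numbers of the second kind
  given by the exponential generating function.
\<close>

lemma Stirling_generating_function:
  "(fps_exp 1 - 1 :: 'a::field_char_0 fps) ^ n =
     fps_const (fact n) * Abs_fps (\<lambda>l. of_nat (Stirling l n) / fact l)"
proof -
  have "fps_nth ((fps_exp 1 - 1 :: 'a fps) ^ n) l = fact n * of_nat (Stirling l n) / fact l" for l
  proof (induction l arbitrary: n)
    case 0
    show ?case by (cases n) simp_all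
  next
    case (Suc l)
    show ?case
    proof (cases n)
      case 0
      thus ?thesis by simp
    next
      case n: (Suc k)
      let ?f = "fps_exp 1 - 1 :: 'a fps"
      have "fps_deriv (?f ^ Suc k) = of_nat (Suc k) * (?f ^ Suc k + ?f ^ k)"
        unfolding fps_deriv_power fps_of_nat by (simp add: algebra_simps)
      hence "of_nat (Suc l) * fps_nth (?f ^ n) (Suc l) =
          of_nat (Suc k) * (fps_nth (?f ^ Suc k) l + fps_nth (?f ^ k) l)"
        unfolding n by (metis fps_deriv_nth Suc_eq_plus1 fps_add_nth fps_of_nat fps_mult_left_const_nth)
      also have "\<dots> = of_nat (Suc k) * (fact (Suc k) * of_nat (Stirling l (Suc k)) / fact l
          + fact k * of_nat (Stirling l k) / fact l)"
        by (simp only: Suc.IH)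
      also have "\<dots> = fact n * of_nat (Stirling (Suc l) n) / fact l"
        unfolding n by (simp add: field_simps)
      finally show ?thesis by (simp add: field_simps del: of_nat_Suc)
    qed
  qed
  thus ?thesis by (intro fps_ext) simp
qed

end

theory Submission
  imports Defs
begin

text \<open>
  The difference equation $E_m(z+1) + E_m(z) = 2z^m$ makes the alternating sum of $(c+a)^m$ over
  $a < M$ with $M$ odd telescope to $(E_m(c) + E_m(c+M))/2$. For $M = p^N$ this tends to $E_m(c)$,
  because $p^N \to 0$ and $E_m$ is a polynomial. Hence the fermionic integral of
  $(-\lambda y + x)^m$ is $(-\lambda)^m E_m(-x/\lambda)$, and both identities follow from the
  Stirling expansions between powers and falling factorials and from the reflection formula
  $E_m(1-z) = (-1)^m E_m(z)$.
\<close>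

section \<open>Euler polynomials\<close>

lemma fps_exp_add_1_times_Euler_series:
  "(fps_exp 1 + 1) * (2 / (fps_exp 1 + 1) * fps_exp x) = 2 * (fps_exp x :: 'a::field_char_0 fps)"
proof -
  \<comment> \<open>The constant term is 2, so the divisor is a unit and the division of power
    series is exact.\<close>
  have "(fps_exp 1 + 1 :: 'a fps) dvd 2"
    by (rule unit_imp_dvd) simp
  then show ?thesis
    by (simp flip: mult.assoc)
qed

text \<open>Moving from \<open>x\<close> to \<open>x + 1\<close> multiplies the generating series by
  e^t, so the sum of the two series acquires the factor e^t + 1, which cancels the
  denominator.\<close>

lemma Euler_poly_difference:
  fixes x :: "'a::field_char_0"
  shows "Euler_poly m (x + 1) + Euler_poly m x = 2 * x ^ m"
proof -
  let ?g = "2 / (fps_exp 1 + 1) :: 'a fps"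
  have "?g * fps_exp (x + 1) + ?g * fps_exp x = 2 * fps_exp x"
    using fps_exp_add_1_times_Euler_series[of x]
    by (simp add: fps_exp_add_mult algebra_simps)
  then have "fps_nth (?g * fps_exp (x + 1)) m + fps_nth (?g * fps_exp x) m
      = fps_nth (fps_const 2 * fps_exp x) m"
    by (simp only: numeral_fps_const flip: fps_add_nth)
  then have "fact m * (fps_nth (?g * fps_exp (x + 1)) m + fps_nth (?g * fps_exp x) m) = 2 * x ^ m"
    by simp
  then show ?thesis
    by (simp only: Euler_poly_def distrib_left)
qed

text \<open>Cauchy product of e^(yt) with the series at \<open>x\<close>. It displays the left side
  as a polynomial in \<open>y\<close>, which yields continuity later.\<close>

lemma Euler_poly_add:
  fixes x y :: "'a::field_char_0"
  shows "Euler_poly m (x + y) = (\<Sum>k\<le>m. of_nat (m choose k) * Euler_poly (m - k) x * y ^ k)"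
proof -
  let ?g = "2 / (fps_exp 1 + 1) :: 'a fps"
  have "Euler_poly m (x + y) = fact m * fps_nth (fps_exp y * (?g * fps_exp x)) m"
    by (simp add: Euler_poly_def fps_exp_add_mult mult_ac)
  also have "\<dots> = (\<Sum>k\<le>m. fact m * (y ^ k / fact k * fps_nth (?g * fps_exp x) (m - k)))"
    by (subst fps_mult_nth) (simp add: sum_distrib_left atLeast0AtMost)
  also have "\<dots> = (\<Sum>k\<le>m. of_nat (m choose k) * Euler_poly (m - k) x * y ^ k)"
    by (rule sum.cong) (simp_all add: Euler_poly_def binomial_fact field_simps)
  finally show ?thesis .
qed

text \<open>Substituting -t for t multiplies the coefficient of t^m by (-1)^m. Extending the
  resulting fraction 2 e^(-zt) / (e^(-t) + 1) by e^t gives 2 e^((1-z)t) / (e^t + 1), the series at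
  \<open>1 - z\<close>.\<close>

lemma Euler_poly_reflect:
  fixes z :: "'a::field_char_0"
  shows "Euler_poly m (1 - z) = (- 1) ^ m * Euler_poly m z"
proof -
  let ?G = "\<lambda>z::'a. 2 / (fps_exp 1 + 1) * fps_exp z"
  let ?neg = "\<lambda>f::'a fps. fps_compose f (fps_const (- 1) * fps_X)"
  have exp_neg: "?neg (fps_exp c) = fps_exp (- c)" for c
    by (rule fps_ext) (simp add: fps_compose_linear power_minus')
  have "?neg ((fps_exp 1 + 1) * ?G z) = ?neg (fps_const 2 * fps_exp z)"
    unfolding fps_exp_add_1_times_Euler_series by (simp add: numeral_fps_const)
  then have "(fps_exp (- 1) + 1) * ?neg (?G z) = 2 * fps_exp (- z)"
    by (simp add: fps_compose_mult_distrib fps_compose_add_distrib exp_neg numeral_fps_const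
        del: fps_const_neg)
  then have "fps_exp 1 * ((fps_exp (- 1) + 1) * ?neg (?G z)) = fps_exp 1 * (2 * fps_exp (- z))"
    by simp
  moreover have "fps_exp 1 * (fps_exp (- 1) + 1) = (fps_exp 1 + 1 :: 'a fps)"
    by (simp add: distrib_left flip: fps_exp_add_mult)
  moreover have "fps_exp 1 * (2 * fps_exp (- z)) = (2 * fps_exp (1 - z))"
    by (simp add: mult.left_commute flip: fps_exp_add_mult)
  ultimately have "(fps_exp 1 + 1) * ?neg (?G z) = (fps_exp 1 + 1) * ?G (1 - z)"
    unfolding fps_exp_add_1_times_Euler_series by (metis mult.assoc)
  moreover have "fps_nth (fps_exp 1 + 1 :: 'a fps) 0 \<noteq> 0"
    by simp
  then have "(fps_exp 1 + 1 :: 'a fps) \<noteq> 0"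
    by (metis fps_zero_nth)
  ultimately have "?neg (?G z) = ?G (1 - z)"
    by simp
  then have "fps_nth (?G (1 - z)) m = fps_nth (?neg (?G z)) m"
    by simp
  also have "\<dots> = (- 1) ^ m * fps_nth (?G z) m"
    by (simp only: fps_compose_linear fps_nth_Abs_fps)
  finally show ?thesis
    by (simp add: Euler_poly_def)
qed

text \<open>Allowing every \<open>M\<close> lets the induction proceed one term at a time; for odd
  \<open>M\<close> the sign turns the difference into a sum.\<close>

lemma alternating_sum_powers:
  fixes c :: "'a::field_char_0"
  shows "(\<Sum>a<M. (c + of_nat a) ^ m * (- 1) ^ a)
    = (Euler_poly m c - (- 1) ^ M * Euler_poly m (c + of_nat M)) / 2"
proof (induction M)
  case (Suc M)
  have step: "Euler_poly m (c + of_nat (Suc M))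
      = 2 * (c + of_nat M) ^ m - Euler_poly m (c + of_nat M)"
    using Euler_poly_difference[of m "c + of_nat M"] by (simp add: algebra_simps)
  show ?case
    unfolding sum.lessThan_Suc Suc.IH step by (simp add: field_simps)
qed simp

section \<open>Powers in terms of falling factorials\<close>

lemma power_eq_sum_Stirling_falling_fact:
  fixes z :: "'a::comm_ring_1"
  shows "z ^ m = (\<Sum>n\<le>m. of_nat (Stirling m n) * falling_fact z n)"
proof (induction m)
  case 0
  show ?case by (simp add: falling_fact_def)
next
  case (Suc m)
  have step: "z * falling_fact z n = falling_fact z (Suc n) + of_nat n * falling_fact z n" for n
    by (simp add: falling_fact_def algebra_simps)
  \<comment> \<open>The range survives the shift: the term at 0 has the factor 0, and the new top
    term contains \<open>Stirling m (Suc m) = 0\<close>.\<close>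
  have shift: "(\<Sum>n\<le>m. of_nat n * of_nat (Stirling m n) * falling_fact z n)
      = (\<Sum>n\<le>m. of_nat (Suc n) * of_nat (Stirling m (Suc n)) * falling_fact z (Suc n))"
    using sum.atMost_Suc_shift[of "\<lambda>n. of_nat n * of_nat (Stirling m n) * falling_fact z n" m]
    by simp
  have "z ^ Suc m = (\<Sum>n\<le>m. of_nat (Stirling m n) * (z * falling_fact z n))"
    by (simp add: Suc sum_distrib_left mult_ac)
  also have "\<dots> = (\<Sum>n\<le>m. of_nat (Stirling m n) * falling_fact z (Suc n))
      + (\<Sum>n\<le>m. of_nat n * of_nat (Stirling m n) * falling_fact z n)"
    unfolding step by (simp add: distrib_left sum.distrib mult_ac)
  \<comment> \<open>This is the recurrence of the Stirling numbers of the second kind.\<close>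
  also have "\<dots> = (\<Sum>n\<le>m. of_nat (Stirling (Suc m) (Suc n)) * falling_fact z (Suc n))"
    unfolding shift by (simp add: algebra_simps sum.distrib)
  also have "\<dots> = (\<Sum>n\<le>Suc m. of_nat (Stirling (Suc m) n) * falling_fact z n)"
    by (subst sum.atMost_Suc_shift) simp
  finally show ?case .
qed

section \<open>Limits with respect to the p-adic absolute value\<close>

context padic_complex
begin

text \<open>Reduces convergence in the field to real null sequences. The sort alone does not tie the
  metric to the field operations, so the limit rules below are derived from the properties of
  \<open>vabs\<close>.\<close>

lemma tendsto_iff_vabs:
  fixes X :: "'b \<Rightarrow> 'a"
  shows "(X \<longlongrightarrow> L) F \<longleftrightarrow> ((\<lambda>n. vabs (X n - L)) \<longlongrightarrow> 0) F"
  by (subst tendsto_dist_iff) (simp add: dist_vabs)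

lemma vabs_nonneg: "vabs z \<ge> 0"
  using zero_le_dist[of z 0] by (simp add: dist_vabs)

lemma vabs_1: "vabs 1 = 1"
proof -
  have "vabs 1 * vabs 1 = vabs 1" and "vabs 1 \<noteq> 0"
    using vabs_mult[of 1 1] dist_vabs[of 1 0] by simp_all (metis dist_eq_0_iff zero_neq_one)
  then show ?thesis by simp
qed

lemma vabs_power: "vabs (z ^ n) = vabs z ^ n"
  by (induction n) (simp_all add: vabs_1 vabs_mult)

lemma tendsto_padic_add:
  fixes X Y :: "'b \<Rightarrow> 'a"
  assumes "(X \<longlongrightarrow> L) F" and "(Y \<longlongrightarrow> K) F"
  shows "((\<lambda>n. X n + Y n) \<longlongrightarrow> L + K) F"
proof -
  \<comment> \<open>The maximum of two nonnegative numbers is at most their sum.\<close>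
  have bound: "vabs (X n + Y n - (L + K)) \<le> vabs (X n - L) + vabs (Y n - K)" for n
    using vabs_ultra[of "X n - L" "Y n - K"] vabs_nonneg[of "X n - L"] vabs_nonneg[of "Y n - K"]
    by (simp add: algebra_simps)
  have lim: "((\<lambda>n. vabs (X n - L) + vabs (Y n - K)) \<longlongrightarrow> 0) F"
    using assms unfolding tendsto_iff_vabs by (rule tendsto_add_zero)
  show ?thesis
    unfolding tendsto_iff_vabs
    by (intro tendsto_0_le[OF lim, where K = 1]) (simp add: bound vabs_nonneg)
qed

lemma tendsto_padic_mult_left:
  fixes X :: "'b \<Rightarrow> 'a"
  assumes "(X \<longlongrightarrow> L) F"
  shows "((\<lambda>n. c * X n) \<longlongrightarrow> c * L) F"
  using tendsto_mult_right_zero[OF assms[unfolded tendsto_iff_vabs], of "vabs c"]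
  unfolding tendsto_iff_vabs by (simp add: vabs_mult flip: right_diff_distrib)

lemma tendsto_padic_sum:
  fixes X :: "'c \<Rightarrow> 'b \<Rightarrow> 'a"
  assumes "\<And>i. i \<in> A \<Longrightarrow> (X i \<longlongrightarrow> L i) F"
  shows "((\<lambda>n. \<Sum>i\<in>A. X i n) \<longlongrightarrow> (\<Sum>i\<in>A. L i)) F"
  using assms by (induction A rule: infinite_finite_induct) (auto intro: tendsto_padic_add)

lemma tendsto_Euler_poly:
  fixes h :: "'b \<Rightarrow> 'a"
  assumes "((\<lambda>n. vabs (h n)) \<longlongrightarrow> 0) F"
  shows "((\<lambda>n. Euler_poly m (c + h n)) \<longlongrightarrow> Euler_poly m c) F"
proof -
  \<comment> \<open>The form \<open>0 ^ k\<close> includes the constant term, where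
    \<open>0 ^ 0 = 1\<close>.\<close>
  have "((\<lambda>n. h n ^ k) \<longlongrightarrow> 0 ^ k) F" for k
  proof (cases k)
    case (Suc j)
    then show ?thesis
      using tendsto_power[OF assms, of k]
      by (simp add: tendsto_iff_vabs vabs_power del: power_Suc)
  qed simp
  \<comment> \<open>Written with \<open>c + 0\<close>, the limit expands by the same addition
    formula, and the sums match term by term.\<close>
  then have "((\<lambda>n. Euler_poly m (c + h n)) \<longlongrightarrow> Euler_poly m (c + 0)) F"
    unfolding Euler_poly_add by (intro tendsto_padic_sum tendsto_padic_mult_left)
  then show ?thesis by simp
qed

section \<open>Fermionic integrals of powers and falling factorials\<close>

lemma fermionic_sums_power:
  fixes c :: 'a
  assumes "odd p"
  shows "(\<lambda>N. \<Sum>a<p ^ N. (c + of_nat a) ^ m * (- 1) ^ a) \<longlonglongrightarrow> Euler_poly m c"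
proof -
  have "p > 1"
    using prime_p prime_gt_1_nat by blast
  then have "(\<lambda>N. vabs (of_nat (p ^ N))) \<longlonglongrightarrow> 0"
    by (simp add: vabs_power vabs_p LIMSEQ_power_zero)
  \<comment> \<open>This is the telescoped sum for \<open>M = p ^ N\<close>, which is odd because
    \<open>p\<close> is.\<close>
  then have "(\<lambda>N. 1 / 2 * (Euler_poly m c + Euler_poly m (c + of_nat (p ^ N))))
      \<longlonglongrightarrow> 1 / 2 * (Euler_poly m c + Euler_poly m c)"
    by (intro tendsto_padic_mult_left tendsto_padic_add tendsto_const tendsto_Euler_poly)
  then show ?thesis
    using assms by (simp add: alternating_sum_powers)
qed

text \<open>Factoring out \<open>- lam\<close> leaves powers of \<open>c + of_nat a\<close> with
  \<open>c = - x / lam\<close>.\<close>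

lemma fermionic_sums_affine_power:
  fixes lam x :: 'a
  assumes "odd p" and "lam \<noteq> 0"
  shows "(\<lambda>N. \<Sum>a<p ^ N. (- lam * of_nat a + x) ^ m * (- 1) ^ a)
    \<longlonglongrightarrow> (- lam) ^ m * Euler_poly m (- x / lam)"
proof -
  have "(- lam * of_nat a + x) ^ m = (- lam) ^ m * (- x / lam + of_nat a) ^ m" for a
    unfolding power_mult_distrib[symmetric] using assms(2) by (simp add: algebra_simps)
  then show ?thesis
    using tendsto_padic_mult_left[OF fermionic_sums_power[OF assms(1)],
        of "(- lam) ^ m" "- x / lam" m]
    by (simp add: sum_distrib_left mult.assoc)
qed

text \<open>Linearity of the limit over the Stirling expansion into powers. Convergence is asserted,
  not just a value, because \<open>lim\<close> is unspecified until the limit exists.\<close>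

lemma fermionic_sums_falling_fact:
  fixes lam x :: 'a
  assumes "odd p" and "lam \<noteq> 0"
  shows "(\<lambda>N. \<Sum>a<p ^ N. falling_fact (- lam * of_nat a + x) n * (- 1) ^ a)
    \<longlonglongrightarrow> (\<Sum>l\<le>n. of_int (Stirling1 n l) * ((- lam) ^ l * Euler_poly l (- x / lam)))"
proof -
  have "(\<Sum>a<p ^ N. falling_fact (- lam * of_nat a + x) n * (- 1) ^ a)
      = (\<Sum>l\<le>n. of_int (Stirling1 n l) * (\<Sum>a<p ^ N. (- lam * of_nat a + x) ^ l * (- 1) ^ a))"
    for N
    unfolding falling_fact_Stirling1 sum_distrib_left sum_distrib_right
    by (subst sum.swap) (simp add: mult.assoc)
  then show ?thesis
    using fermionic_sums_affine_power[OF assms]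
    by (simp only:) (intro tendsto_padic_sum tendsto_padic_mult_left)
qed

lemma Boole2_eq_sum_Stirling1:
  fixes lam x :: 'a
  assumes "odd p" and "lam \<noteq> 0"
  shows "Boole2 p n x lam
    = 1 / 2 * (\<Sum>l\<le>n. of_int (Stirling1 n l) * ((- lam) ^ l * Euler_poly l (- x / lam)))"
  unfolding Boole2_def fermionic_integral_def
  using limI[OF fermionic_sums_falling_fact[OF assms]] by simp

text \<open>Both sides are half the limit of the alternating sums of
  \<open>(- lam * of_nat a + x) ^ m\<close>: on the left after expansion into falling factorials, on
  the right evaluated directly.\<close>

lemma sum_Boole2_Stirling:
  fixes lam x :: 'a
  assumes "odd p" and "lam \<noteq> 0"
  shows "(\<Sum>n\<le>m. Boole2 p n x lam * of_nat (Stirling m n))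
    = 1 / 2 * ((- lam) ^ m * Euler_poly m (- x / lam))"
proof -
  let ?S = "\<lambda>f N. \<Sum>a<p ^ N. f (- lam * of_nat a + x) * (- 1) ^ a"
  define I where "I n = (\<Sum>l\<le>n. of_int (Stirling1 n l) * ((- lam) ^ l * Euler_poly l (- x / lam)))"
    for n
  have sums: "?S (\<lambda>z. z ^ m) N = (\<Sum>n\<le>m. of_nat (Stirling m n) * ?S (\<lambda>z. falling_fact z n) N)"
    for N
    unfolding power_eq_sum_Stirling_falling_fact[of _ m] sum_distrib_left sum_distrib_right
    by (subst sum.swap) (simp add: mult.assoc)
  have "?S (\<lambda>z. z ^ m) \<longlonglongrightarrow> (\<Sum>n\<le>m. of_nat (Stirling m n) * I n)"
    unfolding sums I_def
    by (intro tendsto_padic_sum tendsto_padic_mult_left fermionic_sums_falling_fact assms)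
  then have "(\<Sum>n\<le>m. of_nat (Stirling m n) * I n) = (- lam) ^ m * Euler_poly m (- x / lam)"
    by (rule LIMSEQ_unique) (rule fermionic_sums_affine_power[OF assms])
  moreover have "Boole2 p n x lam = 1 / 2 * I n" for n
    unfolding I_def by (rule Boole2_eq_sum_Stirling1[OF assms])
  then have "(\<Sum>n\<le>m. Boole2 p n x lam * of_nat (Stirling m n))
      = 1 / 2 * (\<Sum>n\<le>m. of_nat (Stirling m n) * I n)"
    by (simp only: sum_distrib_left mult_ac)
  ultimately show ?thesis
    by (simp only:)
qed

end

theorem theorem4:
  fixes p m :: nat
    and vabs :: "'a::{field_char_0, complete_space} \<Rightarrow> real"
    and lam x :: 'a
  assumes "padic_complex p vabs"
    and "odd p"
    and "lam \<in> Z_padic vabs"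
    and "lam \<noteq> 0"
  shows "lam ^ m / 2 * Euler_poly m ((lam + x) / lam)
           = (\<Sum>n\<le>m. Boole2 p n x lam * of_nat (Stirling m n))
       \<and> Boole2 p m x lam
           = (\<Sum>l\<le>m. of_int (Stirling1 m l) * (- 1) ^ l * (lam ^ l / 2) * Euler_poly l (- x / lam))"
proof
  interpret padic_complex p vabs by fact
  have minus: "(- lam) ^ l = (- 1) ^ l * lam ^ l" for l
    by (rule power_minus)
  \<comment> \<open>Prepares the reflection formula, whose sign combines with \<open>lam ^ m\<close>
    to \<open>(- lam) ^ m\<close>.\<close>
  have "(lam + x) / lam = 1 - (- x / lam)"
    using assms(4) by (simp add: field_simps)
  then have "Euler_poly m ((lam + x) / lam) = (- 1) ^ m * Euler_poly m (- x / lam)"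
    by (simp only: Euler_poly_reflect)
  then show "lam ^ m / 2 * Euler_poly m ((lam + x) / lam)
      = (\<Sum>n\<le>m. Boole2 p n x lam * of_nat (Stirling m n))"
    unfolding sum_Boole2_Stirling[OF assms(2,4)] minus by simp
  show "Boole2 p m x lam
      = (\<Sum>l\<le>m. of_int (Stirling1 m l) * (- 1) ^ l * (lam ^ l / 2) * Euler_poly l (- x / lam))"
    unfolding Boole2_eq_sum_Stirling1[OF assms(2,4)] minus sum_distrib_left
    by (rule sum.cong) simp_all
qed

end
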